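(* Let $\mathcal{R}$ be a unital ring with involution, let $m\in\mathcal{R}$ be invertible with $m^*=m$, and let $a,b\in\mathcal{R}^{\mathrm{core},m}$. The following are equivalent: (i) $a^{\mathrm{core},m}ab=ba\,a^{\mathrm{core},m}$, $b^{\mathrm{core},m}ba=ab\,b^{\mathrm{core},m}$ and $a\,a^{\mathrm{core},m}b^{\mathrm{core},m}=b^{\mathrm{core},m}a^{\mathrm{core},m}a$; (ii) $ab,ba\in\mathcal{R}^{\#}$ with $(ab)^{\#}=b^{\mathrm{core},m}a^{\mathrm{core},m}$ and $(ba)^{\#}=a^{\mathrm{core},m}b^{\mathrm{core},m}$.
   Context: $\mathcal{R}$ is a (not necessarily commutative) unital ring with an involution $x\mapsto x^*$ satisfying $(xy)^*=y^*x^*$, $(x+y)^*=x^*+y^*$, $(x^* )^*=x$. For an invertible $m\in\mathcal{R}$ with $m^*=m$, an element $z\in\mathcal{R}$ is the $m$-weighted core inverse of $a\in\mathcal{R}$ if $aza=a$, $z\mathcal{R}=a\mathcal{R}$ and $\mathcal{R}z=\mathcal{R}a^*m$. It is unique if it exists and is denoted $a^{\mathrm{core},m}$; $\mathcal{R}^{\mathrm{core},m}$ is the set of elements that have an $m$-weighted core inverse. The group inverse $a^{\#}$ of $a$ is the (unique, if it exists) element $z$ with $za^2=a$, $zaz=z$, $az=za$; $\mathcal{R}^{\#}$ is the set of group invertible elements. *)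

theory Defs
  imports Main
begin

text \<open>Rings are types of sort \<open>{ring, monoid_mult}\<close>, that is, associative unital rings that need
  not be commutative. The class \<open>ring_1\<close> would in addition exclude the zero ring.\<close>

locale ring_involution =
  fixes star :: "'a::{ring, monoid_mult} \<Rightarrow> 'a"
  assumes star_mult: "star (x * y) = star y * star x"
    and star_add: "star (x + y) = star x + star y"
    and star_star: "star (star x) = x"

definition invertible_elem :: "'a::monoid_mult \<Rightarrow> bool" where
  "invertible_elem x \<longleftrightarrow> (\<exists>y. x * y = 1 \<and> y * x = 1)"

definition right_multiples :: "'a::times \<Rightarrow> 'a set" where
  "right_multiples x = {x * r | r. True}"

definition left_multiples :: "'a::times \<Rightarrow> 'a set" where
  "left_multiples x = {r * x | r. True}"

definition is_wcore_inverse ::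
    "('a::{ring, monoid_mult} \<Rightarrow> 'a) \<Rightarrow> 'a \<Rightarrow> 'a \<Rightarrow> 'a \<Rightarrow> bool" where
  "is_wcore_inverse star m a z \<longleftrightarrow>
     a * z * a = a \<and> right_multiples z = right_multiples a \<and>
     left_multiples z = left_multiples (star a * m)"

definition wcore_invertibles :: "('a::{ring, monoid_mult} \<Rightarrow> 'a) \<Rightarrow> 'a \<Rightarrow> 'a set" where
  "wcore_invertibles star m = {a. \<exists>z. is_wcore_inverse star m a z}"

text \<open>The value is meaningful only for \<open>a \<in> wcore_invertibles star m\<close> with \<open>m\<close> invertible and
  self-adjoint; see \<open>wcore_inverse_unique\<close> and \<open>wcore_inverse_eqI\<close> below. Similarly for
  \<open>group_inverse\<close>.\<close>

definition wcore_inverse :: "('a::{ring, monoid_mult} \<Rightarrow> 'a) \<Rightarrow> 'a \<Rightarrow> 'a \<Rightarrow> 'a" where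
  "wcore_inverse star m a = (THE z. is_wcore_inverse star m a z)"

definition is_group_inverse :: "'a::{ring, monoid_mult} \<Rightarrow> 'a \<Rightarrow> bool" where
  "is_group_inverse a z \<longleftrightarrow> z * a\<^sup>2 = a \<and> z * a * z = z \<and> a * z = z * a"

definition group_invertibles :: "'a::{ring, monoid_mult} set" where
  "group_invertibles = {a. \<exists>z. is_group_inverse a z}"

definition group_inverse :: "'a::{ring, monoid_mult} \<Rightarrow> 'a" where
  "group_inverse a = (THE z. is_group_inverse a z)"

lemma group_inverse_unique:
  assumes z: "is_group_inverse a z" and w: "is_group_inverse a w"
  shows "z = w"
proof -
  have z': "z * (a * a) = a" "z * a * z = z" "a * z = z * a"
    and w': "w * (a * a) = a" "w * a * w = w" "a * w = w * a"
    using z w by (simp_all add: is_group_inverse_def power2_eq_square)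
  have "z * a = z * (w * (a * a))" using w' by simp
  also have "w * (a * a) = w * a * a" by (simp add: mult.assoc)
  also have "\<dots> = a * (w * a)" by (simp add: mult.assoc flip: w'(3))
  also have "\<dots> = a * a * w" by (simp add: mult.assoc w'(3))
  also have "z * (a * a * w) = z * (a * a) * w" by (simp add: mult.assoc)
  also have "\<dots> = w * a" using z' w' by (simp only: z' w'(3))
  finally have *: "z * a = w * a" .
  have "z = z * a * z" using z' by simp
  also have "\<dots> = w * (a * z)" using * by (simp add: mult.assoc)
  also have "\<dots> = w * (a * w)" using * z' w' by simp
  also have "\<dots> = w" using w'(2) by (simp add: mult.assoc)
  finally show ?thesis .
qed

lemma group_inverse_eqI:
  assumes "is_group_inverse a z"
  shows "group_inverse a = z"
  unfolding group_inverse_def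
  using assms group_inverse_unique by (intro the_equality)

context ring_involution
begin

lemma star_one: "star 1 = 1"
  by (metis mult_1_left mult_1_right star_mult star_star)

lemma is_wcore_inverse_facts:
  assumes m: "m * n = 1" "n * m = 1" "star m = m"
    and z: "is_wcore_inverse star m a z"
  shows "a * z * a = a" "z * a * z = z" "star (a * z) = m * (a * z) * n"
    "\<exists>x. z = a * x" "\<exists>y. a = z * y"
proof -
  show aza: "a * z * a = a" using z by (simp add: is_wcore_inverse_def)
  have R: "right_multiples z = right_multiples a"
    and L: "left_multiples z = left_multiples (star a * m)"
    using z by (simp_all add: is_wcore_inverse_def)
  show "\<exists>x. z = a * x" "\<exists>y. a = z * y"
    using R unfolding right_multiples_def set_eq_iff mem_Collect_eq
    by (metis mult_1_right)+
  obtain s where s: "z = s * (star a * m)"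
    using L unfolding left_multiples_def set_eq_iff mem_Collect_eq by (metis mult_1_left)
  define p where "p = a * z"
  have ap: "star a * star p = star a" using aza by (simp add: p_def flip: star_mult)
  have pp: "star p * star p = star p"
    using aza by (simp add: p_def flip: star_mult) (metis mult.assoc)
  have n: "star n = n"
    by (metis m mult.assoc mult_1_left mult_1_right star_mult star_one)
  have pn: "p * n = a * s * star a"
    by (simp add: p_def mult.assoc m) (simp add: s mult.assoc m)
  have "p * n * star p = p * n"
    unfolding pn by (simp add: mult.assoc ap)
  then have "star (p * n) = p * n"
    by (metis n star_mult star_star mult.assoc)
  then have "n * star p = p * n" using n by (simp add: star_mult)
  then have sp: "star p = m * p * n"
    by (metis m(1) mult.assoc mult_1_left)
  then show "star (a * z) = m * (a * z) * n" by (simp add: p_def)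
  have "star a * m * p = star a * m"
    by (metis ap sp m(2) mult.assoc mult_1_right)
  then show "z * a * z = z" using s by (metis p_def mult.assoc)
qed

lemma wcore_inverse_unique:
  assumes m: "invertible_elem m" "star m = m"
    and z: "is_wcore_inverse star m a z" and w: "is_wcore_inverse star m a w"
  shows "z = w"
proof -
  obtain n where n: "m * n = 1" "n * m = 1" using m(1) by (auto simp: invertible_elem_def)
  note z' = is_wcore_inverse_facts[OF n m(2) z] and w' = is_wcore_inverse_facts[OF n m(2) w]
  define p q where "p = a * z" and "q = a * w"
  have "p * q = q" using z'(1) by (simp add: p_def q_def flip: mult.assoc)
  then have "star q * star p = star q" by (simp flip: star_mult)
  then have "m * q * n * (m * p * n) = m * q * n"
    using z'(3) w'(3) by (simp add: p_def q_def)
  then have "n * (m * q * n * (m * p * n)) * m = n * (m * q * n) * m" by simp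
  moreover have nm: "n * (m * x) = x" for x by (simp add: n flip: mult.assoc)
  ultimately have "q * p = q" by (simp add: mult.assoc n nm)
  moreover have "q * p = p" using w'(1) by (simp add: p_def q_def flip: mult.assoc)
  ultimately have pq: "a * z = a * w" by (simp add: p_def q_def)
  obtain x y where "w = a * x" "a = z * y" using w'(4) z'(5) by blast
  then have "z * a * w = w" using z'(2) by (metis mult.assoc)
  then show ?thesis using pq z'(2) by (metis mult.assoc)
qed

lemma wcore_inverse_eqI:
  assumes "invertible_elem m" "star m = m" "is_wcore_inverse star m a z"
  shows "wcore_inverse star m a = z"
  unfolding wcore_inverse_def
  using assms wcore_inverse_unique by (intro the_equality)

end

end

theory Submission
  imports Defs
begin

text \<open>Write \<open>x\<close> and \<open>y\<close> for the weighted core inverses of \<open>a\<close> and \<open>b\<close>. The equivalence is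
  a statement about idempotents: it rests only on \<open>a x a = a\<close>, on \<open>x a x = x\<close> and on the equality
  of the right ideals of \<open>x\<close> and \<open>a\<close> (and the same for \<open>b\<close> and \<open>y\<close>), which together amount to
  the equations \<open>a x a = a\<close>, \<open>a x x = x\<close>, \<open>x a a = a\<close>. The weight and the involution enter only to
  make \<open>x\<close> and \<open>y\<close> well defined and to give \<open>x a x = x\<close> and \<open>y b y = y\<close>.

  With the idempotents \<open>e = x a\<close>, \<open>p = a x\<close>, \<open>f = y b\<close>, \<open>q = b y\<close>, the three equations on one
  side of the equivalence read \<open>e b = b p\<close>, \<open>f a = a q\<close> and \<open>p y = y e\<close>. They force
  \<open>f\<close> to commute with \<open>p\<close> and \<open>e\<close> with \<open>q\<close>, and then both \<open>(a b)(y x)\<close> and \<open>(y x)(a b)\<close> equal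
  \<open>f p\<close>, while both \<open>(b a)(x y)\<close> and \<open>(x y)(b a)\<close> equal \<open>e q\<close>; these idempotents act
  as identities where needed.

  Conversely, suppose that \<open>y x\<close> and \<open>x y\<close> are the group inverses of \<open>a b\<close> and \<open>b a\<close>. An element
  and its group inverse generate the same left ideal and the same right ideal. So an idempotent
  that fixes \<open>y x\<close> from one side because of its outer factor there fixes \<open>a b\<close> from that side
  too, and conversely; the same goes for \<open>x y\<close> and \<open>b a\<close>. Each of the three equations then
  holds because both its sides equal the same product: \<open>e b = e b p = b p\<close>,
  \<open>f a = f a q = a q\<close> and \<open>p y = p y e = y e\<close>.\<close>

section \<open>Reflexive inverses with the same right ideal\<close>

text \<open>The last two equations give \<open>x\<close> as a right multiple of \<open>a\<close> and \<open>a\<close> as a right multiple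
  of \<open>x\<close>, and they imply \<open>x a x = x\<close>.\<close>

definition reflexive_inverse_same_range :: "'a::{ring, monoid_mult} \<Rightarrow> 'a \<Rightarrow> bool" where
  "reflexive_inverse_same_range a x \<longleftrightarrow> a * x * a = a \<and> a * x * x = x \<and> x * a * a = a"

text \<open>The products are bracketed to the right, and each identity also comes with a trailing
  factor \<open>t\<close>, so that it rewrites inside any right-bracketed word.\<close>

lemma reflexive_inverse_same_range_simps:
  assumes "reflexive_inverse_same_range a x"
  shows "a * (x * a) = a" "a * (x * x) = x" "x * (a * a) = a" "x * (a * x) = x"
    "a * (x * (a * t)) = a * t" "a * (x * (x * t)) = x * t"
    "x * (a * (a * t)) = a * t" "x * (a * (x * t)) = x * t"
proof -
  show axa: "a * (x * a) = a" and axx: "a * (x * x) = x" and xaa: "x * (a * a) = a"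
    using assms by (simp_all add: reflexive_inverse_same_range_def mult.assoc)
  \<comment> \<open>\<open>x a x = x a (a x x) = (x a a) x x = a x x\<close>\<close>
  show xax: "x * (a * x) = x"
    by (metis axx xaa mult.assoc)
  show "a * (x * (a * t)) = a * t" "a * (x * (x * t)) = x * t"
    "x * (a * (a * t)) = a * t" "x * (a * (x * t)) = x * t"
    by (metis axa axx xaa xax mult.assoc)+
qed

text \<open>As \<open>x\<close> lies in the right ideal of \<open>a\<close>, the idempotent \<open>a x\<close>, which fixes \<open>a\<close> from
  the left, also fixes \<open>x\<close>; as \<open>a\<close> lies in the right ideal of \<open>x\<close>, the idempotent \<open>x a\<close>, which
  fixes \<open>x\<close>, also fixes \<open>a\<close>.\<close>

lemma (in ring_involution) is_wcore_inverse_imp_reflexive_inverse_same_range: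
  assumes "invertible_elem m" "star m = m" "is_wcore_inverse star m a x"
  shows "reflexive_inverse_same_range a x"
proof -
  obtain n where n: "m * n = 1" "n * m = 1"
    using assms(1) by (auto simp: invertible_elem_def)
  note facts = is_wcore_inverse_facts[OF n assms(2,3)]
  obtain r s where r: "x = a * r" and s: "a = x * s"
    using facts(4,5) by blast
  have "a * x * x = x"
    using facts(1) r by (metis mult.assoc)
  moreover have "x * a * a = a"
    using facts(2) s by (metis mult.assoc)
  ultimately show ?thesis
    using facts(1) by (simp add: reflexive_inverse_same_range_def)
qed

section \<open>From the mixed equations to the reverse order law\<close>

lemma is_group_inverse_of_mixed_equations:
  assumes x: "reflexive_inverse_same_range a x" and y: "reflexive_inverse_same_range b y"
    and eb: "x * a * b = b * a * x" and fa: "y * b * a = a * b * y"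
    and py: "a * x * y = y * x * a"
  shows "is_group_inverse (a * b) (y * x)" and "is_group_inverse (b * a) (x * y)"
proof -
  note xs = reflexive_inverse_same_range_simps[OF x]
    and ys = reflexive_inverse_same_range_simps[OF y]
  have eb: "x * (a * b) = b * (a * x)" "x * (a * (b * t)) = b * (a * (x * t))"
    and fa: "y * (b * a) = a * (b * y)" "y * (b * (a * t)) = a * (b * (y * t))"
    and py: "a * (x * y) = y * (x * a)" "a * (x * (y * t)) = y * (x * (a * t))" for t
    using eb fa py by (metis mult.assoc)+
  \<comment> \<open>\<open>f p = p f\<close>, since \<open>y e b\<close> equals both \<open>y b p\<close> and \<open>p y b\<close>\<close>
  have fp: "y * (b * (a * x)) = a * (x * (y * b))"
    by (metis eb(1) py(2) mult.assoc)
  have eq: "x * (a * (b * y)) = b * (y * (x * a))"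
    by (metis eb(2) py(1))
  have ab_yx: "a * b * (y * x) = y * (b * (a * x))"
    by (simp add: mult.assoc fa)
  have yx_ab: "y * x * (a * b) = y * (b * (a * x))"
    by (simp add: mult.assoc eb)
  have ba_xy: "b * a * (x * y) = x * (a * (b * y))"
    by (simp add: mult.assoc eb)
  have xy_ba: "x * y * (b * a) = x * (a * (b * y))"
    by (simp add: mult.assoc fa)
  have "y * x * (a * b) * (a * b) = y * (b * (a * b))"
    unfolding yx_ab by (simp add: mult.assoc xs)
  also have "\<dots> = a * b"
    using fa(2)[of b] ys by simp
  finally have 1: "y * x * (a * b) * (a * b) = a * b" .
  have "y * x * (a * b) * (y * x) = a * (x * (y * (b * (y * x))))"
    unfolding yx_ab fp by (simp add: mult.assoc)
  also have "\<dots> = a * (x * (y * x))"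
    by (simp add: ys)
  also have "\<dots> = y * x"
    by (simp add: py xs)
  finally have 2: "y * x * (a * b) * (y * x) = y * x" .
  show "is_group_inverse (a * b) (y * x)"
    unfolding is_group_inverse_def power2_eq_square using 1 2 ab_yx yx_ab by (metis mult.assoc)
  have "x * y * (b * a) * (b * a) = x * (a * (b * a))"
    unfolding xy_ba by (simp add: mult.assoc ys)
  also have "\<dots> = b * a"
    using eb(2)[of a] xs by simp
  finally have 3: "x * y * (b * a) * (b * a) = b * a" .
  \<comment> \<open>\<open>e q x y = x (f p) y = x (p f) y\<close>, where \<open>x p = x\<close> and \<open>f y = y\<close>\<close>
  have "x * y * (b * a) * (x * y) = x * (y * (b * (a * x)) * y)"
    by (simp add: mult.assoc)
  also have "\<dots> = x * y"
    unfolding fp by (simp add: mult.assoc xs ys)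
  finally have 4: "x * y * (b * a) * (x * y) = x * y" .
  show "is_group_inverse (b * a) (x * y)"
    unfolding is_group_inverse_def power2_eq_square using 3 4 ba_xy xy_ba by (metis mult.assoc)
qed

section \<open>From the reverse order law to the mixed equations\<close>

text \<open>Since \<open>a b\<close> is a left multiple of \<open>y x\<close>, and \<open>x (a x) = x\<close>, the idempotent \<open>p = a x\<close>
  fixes \<open>a b\<close> from the right; since \<open>b a\<close> is a right multiple of \<open>x y\<close>, and \<open>(x a) x = x\<close>, the
  idempotent \<open>e = x a\<close> fixes \<open>b a\<close> from the left. Multiplying the former by \<open>x\<close> on the left and the
  latter by \<open>x\<close> on the right shows that \<open>e b p\<close> is \<open>e b\<close> and \<open>b p\<close>. By the
  symmetry that swaps \<open>a\<close> with \<open>b\<close>, this lemma serves for two of the mixed equations.\<close>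

lemma reverse_order_law_imp_range_equation:
  assumes x: "reflexive_inverse_same_range a x"
    and ab: "is_group_inverse (a * b) (y * x)" and ba: "is_group_inverse (b * a) (x * y)"
  shows "x * a * b = b * a * x"
proof -
  note xs = reflexive_inverse_same_range_simps[OF x]
  have "a * b = a * b * (a * b) * (y * x)"
    using ab unfolding is_group_inverse_def power2_eq_square by (metis mult.assoc)
  then have "a * b * (a * x) = a * b"
    using xs(4) by (metis mult.assoc)
  then have "x * a * b = x * a * b * (a * x)"
    by (simp add: mult.assoc)
  also have "b * a = x * y * (b * a) * (b * a)"
    using ba unfolding is_group_inverse_def power2_eq_square by (simp add: mult.assoc)
  then have "x * a * (b * a) = b * a"
    using xs(8) by (metis mult.assoc)
  then have "x * a * b * (a * x) = b * a * x"
    by (metis mult.assoc)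
  finally show ?thesis .
qed

text \<open>Here \<open>p\<close> fixes \<open>y x\<close> from the left, because \<open>y x\<close> is a right multiple of \<open>a b\<close>, and \<open>e\<close>
  fixes \<open>x y\<close> from the right, because \<open>x y\<close> is a left multiple of \<open>b a\<close>; so \<open>p y e\<close> is both
  \<open>y e\<close> and \<open>p y\<close>.\<close>

lemma reverse_order_law_imp_inverse_equation:
  assumes x: "reflexive_inverse_same_range a x"
    and ab: "is_group_inverse (a * b) (y * x)" and ba: "is_group_inverse (b * a) (x * y)"
  shows "a * x * y = y * x * a"
proof -
  note xs = reflexive_inverse_same_range_simps[OF x]
  have "x * y = x * y * (x * y) * (b * a)"
    using ba unfolding is_group_inverse_def by (metis mult.assoc)
  then have "x * y * (x * a) = x * y"
    using xs(1) by (metis mult.assoc)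
  then have "a * x * y = a * x * y * (x * a)"
    by (simp add: mult.assoc)
  also have "y * x = a * b * (y * x) * (y * x)"
    using ab unfolding is_group_inverse_def by (metis mult.assoc)
  then have "a * x * (y * x) = y * x"
    using xs(5) by (metis mult.assoc)
  then have "a * x * y * (x * a) = y * x * a"
    by (metis mult.assoc)
  finally show ?thesis .
qed

section \<open>The equivalence for weighted core inverses\<close>

lemma group_inverse_eq_iff:
  "c \<in> group_invertibles \<and> group_inverse c = z \<longleftrightarrow> is_group_inverse c z"
  by (auto simp: group_invertibles_def group_inverse_eqI)

theorem theorem4p15:
  fixes star :: "'a::{ring, monoid_mult} \<Rightarrow> 'a" and m a b :: 'a
  assumes "ring_involution star"
    and "invertible_elem m" and "star m = m"
    and "a \<in> wcore_invertibles star m" and "b \<in> wcore_invertibles star m"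
  shows "(wcore_inverse star m a * a * b = b * a * wcore_inverse star m a \<and>
          wcore_inverse star m b * b * a = a * b * wcore_inverse star m b \<and>
          a * wcore_inverse star m a * wcore_inverse star m b
            = wcore_inverse star m b * wcore_inverse star m a * a)
     \<longleftrightarrow> (a * b \<in> group_invertibles \<and> b * a \<in> group_invertibles \<and>
          group_inverse (a * b) = wcore_inverse star m b * wcore_inverse star m a \<and>
          group_inverse (b * a) = wcore_inverse star m a * wcore_inverse star m b)"
proof -
  interpret ring_involution star by fact
  define x y where "x = wcore_inverse star m a" and "y = wcore_inverse star m b"
  have "is_wcore_inverse star m a x" "is_wcore_inverse star m b y"
    using assms(4,5) wcore_inverse_eqI[OF assms(2,3)]
    by (auto simp: x_def y_def wcore_invertibles_def)
  then have x: "reflexive_inverse_same_range a x" and y: "reflexive_inverse_same_range b y"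
    using is_wcore_inverse_imp_reflexive_inverse_same_range assms(2,3) by blast+
  have "x * a * b = b * a * x \<and> y * b * a = a * b * y \<and> a * x * y = y * x * a \<longleftrightarrow>
      is_group_inverse (a * b) (y * x) \<and> is_group_inverse (b * a) (x * y)"
    using is_group_inverse_of_mixed_equations[OF x y]
      reverse_order_law_imp_range_equation[OF x] reverse_order_law_imp_range_equation[OF y]
      reverse_order_law_imp_inverse_equation[OF x]
    by blast
  then show ?thesis
    unfolding x_def y_def by (auto simp flip: group_inverse_eq_iff)
qed

end
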